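(* Given initial data $(A(0),A'(0))\in\mathrm{SL}(3,\mathbb{R})\times\mathbb{M}^3$ with $\operatorname{tr}A'(0)A(0)^{-1}=0$, the system $$A''(t)=\Lambda(A(t))\,A(t)^{-\top},\qquad\Lambda(A(t))\equiv\frac{\operatorname{tr}\bigl[(A'(t)A(t)^{-1})^2\bigr]}{\operatorname{tr}(A(t)^{-\top}A(t)^{-1})},$$ has a unique global solution $A\in C(\mathbb{R},\mathrm{SL}(3,\mathbb{R}))\cap C^\infty(\mathbb{R},\mathbb{M}^3)$. The solution satisfies the conservation law $$E_K(t)\equiv\frac12\operatorname{tr}A'(t)A'(t)^\top=E_K(0),\quad t\in\mathbb{R}.$$ If $E_K(0)>0$, the solution is a geodesic curve in $\mathrm{SL}(3,\mathbb{R})$. As a curve in $\mathbb{M}^3$, its (signed) curvature is $$\kappa(t)=\frac{\operatorname{tr}\bigl[(A'(t)A(t)^{-1})^2\bigr]}{2E_K(0)\,(\operatorname{tr}A(t)^{-\top}A(t)^{-1})^{1/2}}.$$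
   Context: $\mathbb{M}^3\cong\mathbb{R}^9$ is the space of real $3\times3$ matrices with the Euclidean (Hilbert–Schmidt) norm $|A|=(\operatorname{tr}AA^\top)^{1/2}$; $\mathrm{SL}(3,\mathbb{R})=\{A\in\mathbb{M}^3:\det A=1\}$ is regarded as an embedded submanifold of $\mathbb{M}^3$ with the induced Euclidean metric, and $A^{-\top}=(A^{-1})^\top$. Geodesic means: the component of $A''(t)$ tangential to $\mathrm{SL}(3,\mathbb{R})$ at $A(t)$ vanishes. The curvature is taken with sign relative to the unit normal $n(A)=(\operatorname{tr}A^{-\top}A^{-1})^{-1/2}A^{-\top}$ of $\mathrm{SL}(3,\mathbb{R})$: if $\tilde A(s)$ is the arc-length reparametrization, then $\tilde A''(s)=\kappa\,n(\tilde A(s))$ (so $|\kappa|$ is the length of $\tilde A''$). *)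

theory Defs
  imports "HOL-Analysis.Analysis"
begin

text \<open>
  Matrices are elements of \<^typ>\<open>real^3^3\<close>; its Euclidean norm is the Hilbert-Schmidt norm:
\<close>

lemma norm_matrix_sq: "(norm (A :: real^'n^'m))\<^sup>2 = trace (A ** transpose A)"
  by (simp add: power2_norm_eq_inner trace_def matrix_matrix_mult_def transpose_def inner_vec_def)

definition SL3 :: "(real^3^3) set"
  where "SL3 = {A. det A = 1}"

abbreviation inv_transpose :: "real^3^3 \<Rightarrow> real^3^3"
  where "inv_transpose A \<equiv> transpose (matrix_inv A)"

definition vderiv :: "(real \<Rightarrow> 'a::real_normed_vector) \<Rightarrow> real \<Rightarrow> 'a"
  where "vderiv f t = vector_derivative f (at t)"

text \<open>Used for open sets \<open>I\<close> only, hence the two-sided derivatives.\<close>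

definition smooth_curve_on :: "real set \<Rightarrow> (real \<Rightarrow> 'a::real_normed_vector) \<Rightarrow> bool"
  where "smooth_curve_on I f \<longleftrightarrow> (\<forall>n. \<forall>t\<in>I. (vderiv ^^ n) f differentiable (at t))"

text \<open>
  The tangent space at \<open>p\<close> of an embedded submanifold \<open>S\<close> of a normed space, as the set of
  velocities at \<open>p\<close> of smooth curves in \<open>S\<close>.
\<close>

definition tangent_space :: "'a::real_normed_vector set \<Rightarrow> 'a \<Rightarrow> 'a set"
  where "tangent_space S p =
    {v. \<exists>\<gamma> \<epsilon>. \<epsilon> > 0 \<and> smooth_curve_on {-\<epsilon><..<\<epsilon>} \<gamma> \<and> \<gamma> ` {-\<epsilon><..<\<epsilon>} \<subseteq> S
           \<and> \<gamma> 0 = p \<and> vderiv \<gamma> 0 = v}"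

definition tangential_component :: "'a::euclidean_space set \<Rightarrow> 'a \<Rightarrow> 'a \<Rightarrow> 'a"
  where "tangential_component S p v =
    (THE w. w \<in> tangent_space S p \<and> (\<forall>u\<in>tangent_space S p. orthogonal (v - w) u))"

definition geodesic_in :: "'a::euclidean_space set \<Rightarrow> (real \<Rightarrow> 'a) \<Rightarrow> bool"
  where "geodesic_in S A \<longleftrightarrow>
    range A \<subseteq> S \<and> smooth_curve_on UNIV A
    \<and> (\<forall>t. tangential_component S (A t) (vderiv (vderiv A) t) = 0)"

definition Lam :: "(real \<Rightarrow> real^3^3) \<Rightarrow> real \<Rightarrow> real"
  where "Lam A t =
    (let L = vderiv A t ** matrix_inv (A t)
     in trace (L ** L) / trace (inv_transpose (A t) ** matrix_inv (A t)))"

definition global_solution :: "real^3^3 \<Rightarrow> real^3^3 \<Rightarrow> (real \<Rightarrow> real^3^3) \<Rightarrow> bool"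
  where "global_solution A0 V0 A \<longleftrightarrow>
    continuous_on UNIV A \<and> range A \<subseteq> SL3 \<and> smooth_curve_on UNIV A
    \<and> A 0 = A0 \<and> vderiv A 0 = V0
    \<and> (\<forall>t. vderiv (vderiv A) t = Lam A t *\<^sub>R inv_transpose (A t))"

definition kinetic_energy :: "(real \<Rightarrow> real^3^3) \<Rightarrow> real \<Rightarrow> real"
  where "kinetic_energy A t = 1/2 * trace (vderiv A t ** transpose (vderiv A t))"

definition unit_normal :: "real^3^3 \<Rightarrow> real^3^3"
  where "unit_normal A =
    inverse (sqrt (trace (inv_transpose A ** matrix_inv A))) *\<^sub>R inv_transpose A"

text \<open>The arc length is oriented: it is negative for \<open>t < 0\<close>.\<close>

definition arc_length :: "(real \<Rightarrow> 'a::real_normed_vector) \<Rightarrow> real \<Rightarrow> real"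
  where "arc_length A t = (LBINT \<tau>=0..t. norm (vderiv A \<tau>))"

definition arc_length_reparam :: "(real \<Rightarrow> 'a::real_normed_vector) \<Rightarrow> real \<Rightarrow> 'a"
  where "arc_length_reparam A = A \<circ> inv (arc_length A)"

text \<open>
  \<open>has_signed_curvature A \<kappa> t\<close>: at the parameter \<open>t\<close> of \<open>A\<close>, the arc-length reparametrization has
  second derivative \<open>\<kappa>\<close> times the unit normal of \<^const>\<open>SL3\<close>. This determines \<open>\<kappa>\<close> uniquely.
  The bijectivity makes the reparametrization a curve on the whole real line with the same trace
  as \<open>A\<close>.
\<close>

definition has_signed_curvature :: "(real \<Rightarrow> real^3^3) \<Rightarrow> real \<Rightarrow> real \<Rightarrow> bool"
  where "has_signed_curvature A \<kappa> t \<longleftrightarrow>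
    bij (arc_length A)
    \<and> (\<forall>s. arc_length_reparam A differentiable (at s))
    \<and> (vderiv (arc_length_reparam A) has_vector_derivative \<kappa> *\<^sub>R unit_normal (A t))
        (at (arc_length A t))"

end

theory Submission
  imports Defs
begin

text \<open>
  On \<open>SL(3)\<close> the matrix \<open>A\<^sup>-\<^sup>T\<close> is the cofactor matrix \<open>cof A\<close>, which is a quadratic polynomial in
  \<open>A\<close> and the gradient of \<open>det\<close> at \<open>A\<close>. Let \<open>C(A, B)\<close> be the symmetric bilinear map with
  \<open>C(A, A) = cof A\<close>. The form \<open>\<langle>A, C(B, D)\<rangle>\<close> is symmetric in all three arguments, so that along a curve
  with velocity \<open>V\<close>
  \<open>(det A)' = \<langle>cof A, V\<rangle>\<close> and \<open>(cof A)' = 2 C(A, V)\<close>, hence \<open>\<langle>(cof A)', V\<rangle> = 2 \<langle>A, cof V\<rangle>\<close>.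
  For \<open>det A = 1\<close> and \<open>\<langle>cof A, V\<rangle> = 0\<close> the numerator of \<open>\<Lambda>\<close> is
  \<open>tr (V A\<^sup>-\<^sup>1)\<^sup>2 = - 2 \<langle>A, cof V\<rangle>\<close> (lemma \<open>trace_velocity_sq\<close>), and its denominator is \<open>|cof A|\<^sup>2\<close>.
  Hence the system is \<open>A'' = \<mu> cof A\<close> with \<open>\<mu> = - 2 \<langle>A, cof V\<rangle> / |cof A|\<^sup>2\<close>.

  The denominator is replaced by \<open>|cof A|\<^sup>2 + (det A - 1)\<^sup>2\<close>, which agrees with it on \<open>SL(3)\<close> and vanishes
  nowhere, because \<open>cof A = 0\<close> forces \<open>det A = 0\<close>. This gives a locally Lipschitz vector field on all
  pairs \<open>(A, V)\<close>. With \<open>d = det A - 1\<close> and \<open>w = \<langle>cof A, V\<rangle>\<close> its solutions satisfy \<open>d' = w\<close> and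
  \<open>w' = g d\<close> for a continuous \<open>g\<close>; as \<open>(d, w)\<close> starts at zero, it stays there by Gronwall's inequality
  (lemma \<open>constraints_preserved\<close>). Then \<open>\<langle>V, V'\<rangle> = \<mu> w = 0\<close>, which is the conservation law
  (\<open>speed_preserved\<close>). It bounds \<open>|V|\<close>, and therefore \<open>|A|\<close> on bounded time intervals, so that no
  solution can blow up (\<open>global_solution_if_apriori_bounds\<close>). The vector field is built from bilinear maps
  and one inversion of a positive function, and therefore solutions inherit one more derivative than they
  already have: they are smooth.

  The last part is geometry. A tangent vector \<open>u\<close> at \<open>A\<close> satisfies \<open>\<langle>cof A, u\<rangle> = 0\<close>, being the
  velocity of a curve with constant determinant, so \<open>A'' = \<Lambda> cof A\<close> is normal to \<open>SL(3)\<close>. The speed is a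
  constant \<open>c\<close> with \<open>c\<^sup>2 = 2 E\<^sub>K(0)\<close>, the arc length is \<open>c t\<close>, and the second derivative of the
  reparametrized curve is \<open>A''/c\<^sup>2\<close>, from which the curvature can be read off.
\<close>

section \<open>Cofactor matrices and the trace identity\<close>

text \<open>
  The polarization of the quadratic map sending a matrix with rows \<open>a, b, c\<close> to its cofactor matrix,
  whose rows are the cross products \<open>b \<times> c\<close>, \<open>c \<times> a\<close>, \<open>a \<times> b\<close>.
\<close>

definition mixed_cofactor :: "real^3^3 \<Rightarrow> real^3^3 \<Rightarrow> real^3^3"
  where "mixed_cofactor A B = (1/2) *\<^sub>R
    vector [cross3 (A$2) (B$3) + cross3 (B$2) (A$3),
            cross3 (A$3) (B$1) + cross3 (B$3) (A$1),
            cross3 (A$1) (B$2) + cross3 (B$1) (A$2)]"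

abbreviation cofactor_matrix :: "real^3^3 \<Rightarrow> real^3^3"
  where "cofactor_matrix A \<equiv> mixed_cofactor A A"

lemma mixed_cofactor_rows:
  "mixed_cofactor A B $ 1 = (1/2) *\<^sub>R (cross3 (A$2) (B$3) + cross3 (B$2) (A$3))"
  "mixed_cofactor A B $ 2 = (1/2) *\<^sub>R (cross3 (A$3) (B$1) + cross3 (B$3) (A$1))"
  "mixed_cofactor A B $ 3 = (1/2) *\<^sub>R (cross3 (A$1) (B$2) + cross3 (B$1) (A$2))"
  by (simp_all add: mixed_cofactor_def)

lemma cross3_components:
  "cross3 a b $ 1 = a$2 * b$3 - a$3 * b$2"
  "cross3 a b $ 2 = a$3 * b$1 - a$1 * b$3"
  "cross3 a b $ 3 = a$1 * b$2 - a$2 * b$1"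
  by (simp_all add: cross3_def)

lemmas entrywise = mixed_cofactor_rows cross3_components inner_vec_def sum_3 det_3
  trace_def matrix_matrix_mult_def transpose_def

lemma bounded_bilinear_mixed_cofactor: "bounded_bilinear mixed_cofactor"
  unfolding bilinear_conv_bounded_bilinear[symmetric] bilinear_def
  by (auto intro!: linearI simp: vec_eq_iff forall_3 mixed_cofactor_rows cross3_components
      algebra_simps)

lemma mixed_cofactor_commute: "mixed_cofactor A B = mixed_cofactor B A"
  by (simp add: mixed_cofactor_def add.commute)

text \<open>
  Up to a constant factor \<open>\<langle>A, C(B, D)\<rangle>\<close> is the polarization of the cubic form \<open>det\<close>. Together with
  \<open>mixed_cofactor_commute\<close> the swap gives its symmetry in all three arguments.
\<close>

lemma inner_mixed_cofactor_swap: "inner A (mixed_cofactor B C) = inner B (mixed_cofactor A C)"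
  by (simp add: entrywise field_simps)

lemma inner_cofactor_self: "inner A (cofactor_matrix A) = 3 * det A"
  by (simp add: entrywise field_simps)

lemma cofactor_mult_right: "A ** transpose (cofactor_matrix A) = det A *\<^sub>R mat 1"
  by (simp add: vec_eq_iff forall_3 entrywise mat_def field_simps)

lemma matrix_inv_eqI:
  fixes A :: "'a::field^'n^'n"
  assumes "A ** B = mat 1" shows "matrix_inv A = B"
proof -
  have "invertible A"
    using assms invertible_right_inverse by blast
  then have "matrix_inv A ** A = mat 1"
    unfolding invertible_def matrix_inv_def by (rule someI2_ex) blast
  then show ?thesis
    by (metis assms matrix_mul_assoc matrix_mul_lid matrix_mul_rid)
qed

lemma matrix_inv_SL3: "A \<in> SL3 \<Longrightarrow> matrix_inv A = transpose (cofactor_matrix A)"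
  by (rule matrix_inv_eqI) (simp add: cofactor_mult_right SL3_def)

lemma inner_eq_trace: "inner A B = trace (A ** transpose B)" for A B :: "real^'n^'m"
  by (simp add: trace_def matrix_matrix_mult_def transpose_def inner_vec_def)

lemma inner_cofactor_eq_trace:
  "A \<in> SL3 \<Longrightarrow> inner (cofactor_matrix A) V = trace (V ** matrix_inv A)"
  by (simp add: inner_commute inner_eq_trace[of V] matrix_inv_SL3)

lemma trace_inv_transpose:
  "A \<in> SL3 \<Longrightarrow> trace (inv_transpose A ** matrix_inv A) = (norm (cofactor_matrix A))\<^sup>2"
  by (simp add: matrix_inv_SL3 norm_matrix_sq)

lemma cofactor_matrix_mult:
  "cofactor_matrix (A ** B) = cofactor_matrix A ** cofactor_matrix B"
  by (simp add: vec_eq_iff forall_3 entrywise algebra_simps)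

lemma cofactor_transpose: "cofactor_matrix (transpose A) = transpose (cofactor_matrix A)"
  by (simp add: vec_eq_iff forall_3 entrywise algebra_simps)

text \<open>
  The second elementary symmetric function of the eigenvalues of \<open>L\<close> is the trace of its cofactor
  matrix, so this is Newton's identity for the power sum of degree two.
\<close>

lemma trace_sq: "trace (L ** L) = (trace L)\<^sup>2 - 2 * trace (cofactor_matrix L)"
  by (simp add: entrywise algebra_simps power2_eq_square)

lemma cofactor_cofactor: "cofactor_matrix (cofactor_matrix A) = det A *\<^sub>R A"
  by (simp add: vec_eq_iff forall_3 entrywise algebra_simps)

text \<open>
  This turns the numerator of \<open>\<Lambda>\<close> into a polynomial: by multiplicativity the cofactor matrix of \<open>V A\<^sup>-\<^sup>1\<close>
  is \<open>cof V A\<^sup>T\<close>, with trace \<open>\<langle>cof V, A\<rangle>\<close>. The first term is the square of \<open>tr (V A\<^sup>-\<^sup>1)\<close>, which is zero for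
  tangent vectors \<open>V\<close>.
\<close>

lemma trace_velocity_sq:
  assumes "A \<in> SL3"
  shows "trace ((V ** matrix_inv A) ** (V ** matrix_inv A))
    = (inner (cofactor_matrix A) V)\<^sup>2 - 2 * inner A (cofactor_matrix V)"
proof -
  have "cofactor_matrix (V ** matrix_inv A) = cofactor_matrix V ** transpose A"
    using assms by (simp add: cofactor_matrix_mult matrix_inv_SL3 cofactor_transpose
        cofactor_cofactor SL3_def)
  then show ?thesis
    using assms inner_eq_trace[of "cofactor_matrix V" A]
    by (simp add: trace_sq inner_cofactor_eq_trace inner_commute[of A])
qed

section \<open>Growth estimates from derivatives\<close>

lemma has_vector_derivative_scaled_argument:
  fixes f :: "real \<Rightarrow> 'a::real_normed_vector"
  assumes "(f has_vector_derivative f') (at (s * v))"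
  shows "((\<lambda>v. f (s * v)) has_vector_derivative s *\<^sub>R f') (at v)"
  using vector_diff_chain_at[of "\<lambda>v. s * v" s v f f']
    has_vector_derivative_mult_right[OF has_vector_derivative_id, of s "at v"] assms
  by (simp add: o_def)

lemma continuous_on_if_has_vector_derivative:
  assumes "\<And>t. t \<in> S \<Longrightarrow> (f has_vector_derivative f' t) (at t)"
  shows "continuous_on S f"
  by (rule continuous_at_imp_continuous_on) (blast intro: assms has_vector_derivative_continuous)

lemma continuous_on_compact_norm_bound:
  fixes f :: "'a::topological_space \<Rightarrow> 'b::real_normed_vector"
  assumes "compact K" and "continuous_on K f"
  shows "\<exists>b. \<forall>x\<in>K. norm (f x) \<le> b"
proof -
  have "bounded (f ` K)"
    using assms by (intro compact_imp_bounded compact_continuous_image)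
  then show ?thesis unfolding bounded_iff by blast
qed

text \<open>
  The function \<open>exp (- 2 L t) |D(t)|\<^sup>2\<close> is nonincreasing for \<open>t \<ge> 0\<close>. Negative times are treated by applying the
  same argument to \<open>D(-t)\<close>, which is why the proof carries a sign \<open>s\<close>.
\<close>

lemma gronwall_zero:
  fixes D :: "real \<Rightarrow> 'a::real_inner"
  assumes deriv: "\<And>t. \<bar>t\<bar> \<le> T \<Longrightarrow> (D has_vector_derivative D' t) (at t)"
    and bound: "\<And>t. \<bar>t\<bar> \<le> T \<Longrightarrow> norm (D' t) \<le> L * norm (D t)"
    and "D 0 = 0" and "\<bar>t\<bar> \<le> T"
  shows "D t = 0"
proof -
  define h where "h s t = exp (- (2 * L * t)) * (D (s * t) \<bullet> D (s * t))" for s t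
  have "D (s * u) = 0" if "s \<in> {1, -1}" "0 \<le> u" "u \<le> T" for s u
  proof -
    have "\<exists>y. (h s has_real_derivative y) (at v) \<and> y \<le> 0" if v: "0 \<le> v" "v \<le> u" for v
    proof (intro exI conjI)
      have T: "\<bar>s * v\<bar> \<le> T" using v \<open>s \<in> _\<close> \<open>u \<le> T\<close> by auto
      have 1: "((\<lambda>v. D (s * v)) has_vector_derivative s *\<^sub>R D' (s * v)) (at v)"
        by (intro has_vector_derivative_scaled_argument deriv T)
      have 2: "((\<lambda>v. D (s * v) \<bullet> D (s * v)) has_real_derivative
          2 * s * (D (s * v) \<bullet> D' (s * v))) (at v)"
        using bounded_bilinear.has_vector_derivative[OF bounded_bilinear_inner 1 1]
        by (simp add: has_real_derivative_iff_has_vector_derivative inner_commute mult.assoc)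
      have 3: "((\<lambda>v. exp (- (2 * L * v))) has_real_derivative - (2 * L) * exp (- (2 * L * v))) (at v)"
        by (auto intro!: derivative_eq_intros)
      show "(h s has_real_derivative exp (- (2 * L * v)) *
          (2 * s * (D (s * v) \<bullet> D' (s * v)) - 2 * L * (D (s * v) \<bullet> D (s * v)))) (at v)"
        unfolding h_def by (rule DERIV_cong[OF DERIV_mult[OF 3 2]]) (simp add: algebra_simps)
      have "\<bar>D (s * v) \<bullet> D' (s * v)\<bar> \<le> norm (D (s * v)) * norm (D' (s * v))"
        by (rule Cauchy_Schwarz_ineq2)
      also have "\<dots> \<le> norm (D (s * v)) * (L * norm (D (s * v)))"
        using bound[OF T] by (intro mult_left_mono) auto
      finally have "\<bar>D (s * v) \<bullet> D' (s * v)\<bar> \<le> L * (D (s * v) \<bullet> D (s * v))"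
        by (simp add: dot_square_norm power2_eq_square mult_ac)
      then show "exp (- (2 * L * v)) *
          (2 * s * (D (s * v) \<bullet> D' (s * v)) - 2 * L * (D (s * v) \<bullet> D (s * v))) \<le> 0"
        using \<open>s \<in> _\<close> by (intro mult_nonneg_nonpos) auto
    qed
    then have "h s u \<le> h s 0"
      by (rule DERIV_nonpos_imp_nonincreasing[OF \<open>0 \<le> u\<close>])
    then have "D (s * u) \<bullet> D (s * u) \<le> 0"
      by (simp add: h_def \<open>D 0 = 0\<close> mult_le_0_iff)
    then show ?thesis using inner_eq_zero_iff inner_ge_zero antisym by metis
  qed
  note zero = this
  show ?thesis
  proof (cases "t = 0")
    case False
    then have "sgn t \<in> {1, -1}" by (simp add: sgn_if)
    then have "D (sgn t * \<bar>t\<bar>) = 0" by (rule zero) (use \<open>\<bar>t\<bar> \<le> T\<close> in auto)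
    then show ?thesis by (simp only: sgn_mult_abs)
  qed (simp add: \<open>D 0 = 0\<close>)
qed

text \<open>
  Integration reproduces the weight \<open>exp (\<alpha> |t|)\<close> and gains a factor \<open>1 / \<alpha>\<close>. For large \<open>\<alpha>\<close> this makes integration a contraction in an exponentially weighted norm.
\<close>

lemma exp_growth_of_derivative:
  fixes g :: "real \<Rightarrow> 'a::real_normed_vector"
  assumes deriv: "\<And>t. (g has_vector_derivative g' t) (at t)" and "g 0 = 0"
    and bound: "\<And>t. norm (g' t) \<le> C * exp (\<alpha> * \<bar>t\<bar>)" and "\<alpha> > 0"
  shows "norm (g t) \<le> C / \<alpha> * exp (\<alpha> * \<bar>t\<bar>)"
proof -
  have "norm (g' 0) \<le> C" using bound[of 0] by simp
  then have "C \<ge> 0" using norm_ge_zero order_trans by blast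
  show ?thesis
  proof (cases "t = 0")
    case True
    then show ?thesis using \<open>g 0 = 0\<close> \<open>C \<ge> 0\<close> \<open>\<alpha> > 0\<close> by simp
  next
    case False
    define s where "s = sgn t"
    have s: "s \<in> {1, -1}" "s * \<bar>t\<bar> = t" using False by (auto simp: s_def sgn_if)
    define G where "G v = g (s * v)" for v
    have G: "(G has_vector_derivative s *\<^sub>R g' (s * v)) (at v)" for v
      unfolding G_def by (intro has_vector_derivative_scaled_argument deriv)
    have "norm (G \<bar>t\<bar> - G 0) \<le> C / \<alpha> * exp (\<alpha> * \<bar>t\<bar>) - C / \<alpha> * exp (\<alpha> * 0)"
    proof (rule differentiable_bound_general[where \<phi> = "\<lambda>v. C / \<alpha> * exp (\<alpha> * v)" and a = 0 and b = "\<bar>t\<bar>"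
          and f = G and f' = "\<lambda>v. s *\<^sub>R g' (s * v)" and \<phi>' = "\<lambda>v. C * exp (\<alpha> * v)"])
      show "continuous_on {0..\<bar>t\<bar>} G"
        by (rule continuous_on_if_has_vector_derivative) (rule G)
      show "continuous_on {0..\<bar>t\<bar>} (\<lambda>v. C / \<alpha> * exp (\<alpha> * v))"
        by (intro continuous_intros)
      fix v assume v: "0 < v" "v < \<bar>t\<bar>"
      show "((\<lambda>v. C / \<alpha> * exp (\<alpha> * v)) has_vector_derivative C * exp (\<alpha> * v)) (at v)"
        unfolding has_real_derivative_iff_has_vector_derivative[symmetric]
        using \<open>\<alpha> > 0\<close> by (auto intro!: derivative_eq_intros)
      show "norm (s *\<^sub>R g' (s * v)) \<le> C * exp (\<alpha> * v)"
        using bound[of "s * v"] s v by (auto simp: abs_mult)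
    qed (use False G in auto)
    moreover have "G \<bar>t\<bar> = g t" "G 0 = 0" by (simp_all add: G_def s \<open>g 0 = 0\<close>)
    moreover have "C / \<alpha> \<ge> 0" using \<open>C \<ge> 0\<close> \<open>\<alpha> > 0\<close> by simp
    ultimately show ?thesis by simp
  qed
qed

section \<open>Picard iteration for bounded Lipschitz fields\<close>

lemma primitive_has_vector_derivative:
  fixes f :: "real \<Rightarrow> 'a::euclidean_space"
  assumes "continuous_on UNIV f"
  shows "((\<lambda>t. LBINT s=0..t. f s) has_vector_derivative f t) (at t)"
proof -
  define T where "T = \<bar>t\<bar> + 1"
  have "((\<lambda>t. LBINT s=ereal 0..t. f s) has_vector_derivative f t) (at t within {-T..T})"
    by (rule interval_integral_FTC2) (auto simp: T_def intro: continuous_on_subset[OF assms])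
  moreover have "at t within {-T..T} = at t"
    by (rule at_within_interior) (auto simp: T_def)
  ultimately show ?thesis by (simp add: zero_ereal_def)
qed

text \<open>
  The Picard operator \<open>X \<mapsto> x0 + \<integral> F(X)\<close> is a contraction with respect to \<open>sup |X(t)| exp (- \<alpha> |t|)\<close> as soon as
  \<open>\<alpha> > L\<close>, so one application of Banach's theorem gives a solution on the whole line. To work with
  bounded functions, the fixed point is sought for \<open>Z(t) = exp (- \<alpha> |t|) X(t)\<close>; the bound on \<open>F\<close> keeps \<open>Z\<close>
  bounded.
\<close>

lemma picard_bounded_lipschitz:
  fixes F :: "'a::euclidean_space \<Rightarrow> 'a"
  assumes lip: "L-lipschitz_on UNIV F" and bdd: "\<And>x. norm (F x) \<le> M"
  obtains X where "X 0 = x0" "\<And>t. (X has_vector_derivative F (X t)) (at t)"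
proof -
  define \<alpha> where "\<alpha> = 2 * L + 1"
  have "L \<ge> 0" using lip by (rule lipschitz_on_nonneg)
  then have "\<alpha> > 0" by (simp add: \<alpha>_def)
  have "M \<ge> 0" using bdd[of undefined] norm_ge_zero order_trans by blast
  define w where "w t = exp (\<alpha> * \<bar>t\<bar>)" for t
  have w: "w t > 0" "w t \<ge> 1" for t using \<open>\<alpha> > 0\<close> by (simp_all add: w_def)
  have contw: "continuous_on UNIV w" unfolding w_def by (intro continuous_intros)
  have contF: "continuous_on UNIV F" by (rule lipschitz_on_continuous_on[OF lip])
  define J where "J Z t = (LBINT s=0..t. F (w s *\<^sub>R apply_bcontfun Z s))" for Z and t :: real
  have contFZ: "continuous_on UNIV (\<lambda>s. F (w s *\<^sub>R apply_bcontfun Z s))" for Z :: "real \<Rightarrow>\<^sub>C 'a"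
    by (rule continuous_on_compose2[OF contF]) (auto intro!: continuous_intros contw)
  have J: "(J Z has_vector_derivative F (w t *\<^sub>R apply_bcontfun Z t)) (at t)" for Z t
    unfolding J_def by (rule primitive_has_vector_derivative) (rule contFZ)
  have J0: "J Z 0 = 0" for Z by (simp add: J_def zero_ereal_def)
  have contJ: "continuous_on UNIV (J Z)" for Z
    by (rule continuous_on_if_has_vector_derivative) (rule J)
  have Jb: "norm (J Z t) \<le> M / \<alpha> * w t" for Z t
    unfolding w_def
  proof (rule exp_growth_of_derivative[OF J J0 _ \<open>\<alpha> > 0\<close>])
    fix t
    have "norm (F (w t *\<^sub>R apply_bcontfun Z t)) \<le> M * 1" using bdd by simp
    also have "\<dots> \<le> M * exp (\<alpha> * \<bar>t\<bar>)"
      using w(2)[of t] \<open>M \<ge> 0\<close> unfolding w_def by (intro mult_left_mono) auto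
    finally show "norm (F (w t *\<^sub>R apply_bcontfun Z t)) \<le> M * exp (\<alpha> * \<bar>t\<bar>)" .
  qed
  have mem: "(\<lambda>t. inverse (w t) *\<^sub>R (x0 + J Z t)) \<in> bcontfun" for Z
    unfolding bcontfun_def mem_Collect_eq
  proof
    show "continuous_on UNIV (\<lambda>t. inverse (w t) *\<^sub>R (x0 + J Z t))"
      using w by (intro continuous_intros contw contJ) (metis less_irrefl)
    show "bounded (range (\<lambda>t. inverse (w t) *\<^sub>R (x0 + J Z t)))"
      unfolding bounded_iff
    proof (intro exI ballI, elim imageE, simp only:)
      fix t
      have "norm (inverse (w t) *\<^sub>R (x0 + J Z t)) \<le> inverse (w t) * (norm x0 + M / \<alpha> * w t)"
        using w(1)[of t] norm_triangle_le[OF add_left_mono[OF Jb[of Z t]]]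
        by (simp add: mult_left_mono)
      also have "\<dots> \<le> norm x0 + M / \<alpha>"
        using w[of t] by (simp add: field_simps mult_le_cancel_left1)
      finally show "norm (inverse (w t) *\<^sub>R (x0 + J Z t)) \<le> norm x0 + M / \<alpha>" .
    qed
  qed
  define P where "P Z = Bcontfun (\<lambda>t. inverse (w t) *\<^sub>R (x0 + J Z t))" for Z
  have P: "apply_bcontfun (P Z) t = inverse (w t) *\<^sub>R (x0 + J Z t)" for Z t
    unfolding P_def using Bcontfun_inverse[OF mem] by simp
  have "dist (P Y) (P Z) \<le> (L / \<alpha>) * dist Y Z" for Y Z
  proof (rule dist_bound)
    fix t
    have d: "((\<lambda>t. J Y t - J Z t) has_vector_derivative
        F (w t *\<^sub>R apply_bcontfun Y t) - F (w t *\<^sub>R apply_bcontfun Z t)) (at t)" for t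
      by (intro has_vector_derivative_diff J)
    have "norm (J Y t - J Z t) \<le> (L * dist Y Z) / \<alpha> * exp (\<alpha> * \<bar>t\<bar>)"
    proof (rule exp_growth_of_derivative[OF d _ _ \<open>\<alpha> > 0\<close>])
      fix t
      have "norm (F (w t *\<^sub>R apply_bcontfun Y t) - F (w t *\<^sub>R apply_bcontfun Z t))
          \<le> L * norm (w t *\<^sub>R apply_bcontfun Y t - w t *\<^sub>R apply_bcontfun Z t)"
        by (rule lipschitz_on_normD[OF lip]) auto
      also have "\<dots> = L * w t * dist (apply_bcontfun Y t) (apply_bcontfun Z t)"
        using w(1)[of t] by (simp add: dist_norm scaleR_diff_right[symmetric])
      also have "\<dots> \<le> L * w t * dist Y Z"
        using w(1)[of t] \<open>L \<ge> 0\<close> by (intro mult_left_mono dist_bounded) auto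
      finally show "norm (F (w t *\<^sub>R apply_bcontfun Y t) - F (w t *\<^sub>R apply_bcontfun Z t))
          \<le> L * dist Y Z * exp (\<alpha> * \<bar>t\<bar>)"
        by (simp add: w_def mult_ac)
    qed (simp add: J0)
    then have "norm (J Y t - J Z t) \<le> (L / \<alpha> * dist Y Z) * w t" by (simp add: w_def)
    moreover have "apply_bcontfun (P Y) t - apply_bcontfun (P Z) t = inverse (w t) *\<^sub>R (J Y t - J Z t)"
      by (simp add: P scaleR_diff_right[symmetric])
    then have "dist (apply_bcontfun (P Y) t) (apply_bcontfun (P Z) t) = norm (J Y t - J Z t) / w t"
      using w(1)[of t] by (simp add: dist_norm divide_inverse mult.commute)
    ultimately show "dist (apply_bcontfun (P Y) t) (apply_bcontfun (P Z) t) \<le> L / \<alpha> * dist Y Z"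
      using w(1)[of t] by (simp only: pos_divide_le_eq)
  qed
  moreover have "0 \<le> L / \<alpha>" "L / \<alpha> < 1" using \<open>L \<ge> 0\<close> by (simp_all add: \<alpha>_def)
  ultimately have "\<exists>!Z. P Z = Z" by (intro banach_fix_type[of "L / \<alpha>"]) auto
  then obtain Z where Z: "P Z = Z" by blast
  \<comment> \<open>Undoing the weight turns the fixed point equation into the integral equation.\<close>
  have X: "w t *\<^sub>R apply_bcontfun Z t = x0 + J Z t" for t
    using P[of Z t] w(1)[of t] unfolding Z by simp
  have "((\<lambda>t. x0 + J Z t) has_vector_derivative F (x0 + J Z t)) (at t)" for t
    using J[of Z t] unfolding X by (auto intro!: derivative_eq_intros)
  then show thesis using that[of "\<lambda>t. x0 + J Z t"] J0 by simp
qed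

section \<open>Locally Lipschitz maps\<close>

text \<open>
  On locally compact spaces this amounts to the usual condition on neighbourhoods. Compact sets are
  convenient because values on them are bounded, and bounded away from zero for positive functions, as the
  rules for products and reciprocals require.
\<close>

definition locally_lipschitz :: "('a::metric_space \<Rightarrow> 'b::metric_space) \<Rightarrow> bool"
  where "locally_lipschitz f \<longleftrightarrow> (\<forall>K. compact K \<longrightarrow> (\<exists>L. L-lipschitz_on K f))"

lemma locally_lipschitz_continuous_on:
  assumes "locally_lipschitz f" and "compact K"
  shows "continuous_on K f"
  using assms lipschitz_on_continuous_on unfolding locally_lipschitz_def by blast

lemma locally_lipschitz_linear:
  assumes "bounded_linear f" shows "locally_lipschitz f"
proof -
  obtain L where "L-lipschitz_on UNIV f"
    by (rule bounded_linear.lipschitz_boundE[OF assms])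
  then show ?thesis
    unfolding locally_lipschitz_def using lipschitz_on_subset by blast
qed

lemma locally_lipschitz_const: "locally_lipschitz (\<lambda>x. c)"
  unfolding locally_lipschitz_def using lipschitz_on_constant by blast

lemma locally_lipschitz_add:
  fixes f g :: "'a::metric_space \<Rightarrow> 'b::real_normed_vector"
  shows "locally_lipschitz f \<Longrightarrow> locally_lipschitz g \<Longrightarrow> locally_lipschitz (\<lambda>x. f x + g x)"
  unfolding locally_lipschitz_def by (blast intro: lipschitz_on_add)

lemma locally_lipschitz_Pair:
  "locally_lipschitz f \<Longrightarrow> locally_lipschitz g \<Longrightarrow> locally_lipschitz (\<lambda>x. (f x, g x))"
  unfolding locally_lipschitz_def by (blast intro: lipschitz_on_Pair)

lemma locally_lipschitz_bilinear:
  fixes f :: "'a::metric_space \<Rightarrow> 'b::real_normed_vector"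
    and g :: "'a \<Rightarrow> 'c::real_normed_vector" and h :: "'b \<Rightarrow> 'c \<Rightarrow> 'd::real_normed_vector"
  assumes h: "bounded_bilinear h" and f: "locally_lipschitz f" and g: "locally_lipschitz g"
  shows "locally_lipschitz (\<lambda>x. h (f x) (g x))"
  unfolding locally_lipschitz_def
proof (intro allI impI)
  fix K :: "'a set" assume K: "compact K"
  obtain Lf Lg where Lf: "Lf-lipschitz_on K f" and Lg: "Lg-lipschitz_on K g"
    using f g K unfolding locally_lipschitz_def by blast
  obtain a where a: "\<And>x. x \<in> K \<Longrightarrow> norm (f x) \<le> a"
    using continuous_on_compact_norm_bound[OF K locally_lipschitz_continuous_on[OF f K]] by blast
  obtain b where b: "\<And>x. x \<in> K \<Longrightarrow> norm (g x) \<le> b"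
    using continuous_on_compact_norm_bound[OF K locally_lipschitz_continuous_on[OF g K]] by blast
  obtain C where C: "0 < C" "\<And>x y. norm (h x y) \<le> norm x * norm y * C"
    using bounded_bilinear.pos_bounded[OF h] by blast
  define L where "L = \<bar>a\<bar> * Lg * C + Lf * \<bar>b\<bar> * C"
  have nn: "Lf \<ge> 0" "Lg \<ge> 0" using Lf Lg lipschitz_on_nonneg by auto
  have "L-lipschitz_on K (\<lambda>x. h (f x) (g x))"
  proof (rule lipschitz_onI)
    show "L \<ge> 0" using nn C by (simp add: L_def)
    fix x y assume xy: "x \<in> K" "y \<in> K"
    \<comment> \<open>The product rule for differences.\<close>
    have "h (f x) (g x) - h (f y) (g y) = h (f x) (g x - g y) + h (f x - f y) (g y)"
      by (simp add: bounded_bilinear.diff_left[OF h] bounded_bilinear.diff_right[OF h])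
    then have "dist (h (f x) (g x)) (h (f y) (g y))
        \<le> norm (f x) * dist (g x) (g y) * C + dist (f x) (f y) * norm (g y) * C"
      unfolding dist_norm by (simp only:) (intro norm_triangle_mono C(2))
    also have "\<dots> \<le> \<bar>a\<bar> * (Lg * dist x y) * C + (Lf * dist x y) * \<bar>b\<bar> * C"
      using a[OF xy(1)] b[OF xy(2)] lipschitz_onD[OF Lf xy] lipschitz_onD[OF Lg xy] C(1) nn
      by (intro add_mono mult_mono) auto
    finally show "dist (h (f x) (g x)) (h (f y) (g y)) \<le> L * dist x y"
      by (simp add: L_def algebra_simps)
  qed
  then show "\<exists>L. L-lipschitz_on K (\<lambda>x. h (f x) (g x))" by blast
qed

lemma locally_lipschitz_inverse:
  fixes f :: "'a::metric_space \<Rightarrow> real"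
  assumes f: "locally_lipschitz f" and pos: "\<And>x. f x > 0"
  shows "locally_lipschitz (\<lambda>x. inverse (f x))"
  unfolding locally_lipschitz_def
proof (intro allI impI)
  fix K :: "'a set" assume K: "compact K"
  show "\<exists>L. L-lipschitz_on K (\<lambda>x. inverse (f x))"
  proof (cases "K = {}")
    case True then show ?thesis by (auto intro: exI[of _ 0])
  next
    case False
    then obtain y where y: "y \<in> K" "\<And>x. x \<in> K \<Longrightarrow> f y \<le> f x"
      using continuous_attains_inf[OF K False locally_lipschitz_continuous_on[OF f K]] by blast
    obtain Lf where Lf: "Lf-lipschitz_on K f"
      using f K unfolding locally_lipschitz_def by blast
    define m where "m = f y"
    have m: "m > 0" "\<And>x. x \<in> K \<Longrightarrow> m \<le> f x" using y pos by (auto simp: m_def)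
    have "(Lf / m\<^sup>2)-lipschitz_on K (\<lambda>x. inverse (f x))"
    proof (rule lipschitz_onI)
      fix x z assume xz: "x \<in> K" "z \<in> K"
      have "dist (inverse (f x)) (inverse (f z)) = dist (f x) (f z) / (f x * f z)"
        using pos[of x] pos[of z] by (simp add: dist_real_def field_simps abs_minus_commute abs_mult)
      also have "\<dots> \<le> (Lf * dist x z) / (m * m)"
        using lipschitz_onD[OF Lf xz] m xz lipschitz_on_nonneg[OF Lf]
        by (intro frac_le mult_mono) (auto intro: less_imp_le pos)
      finally show "dist (inverse (f x)) (inverse (f z)) \<le> Lf / m\<^sup>2 * dist x z"
        by (simp add: power2_eq_square)
    qed (use lipschitz_on_nonneg[OF Lf] in auto)
    then show ?thesis by blast
  qed
qed

section \<open>Continuation of solutions with a priori bounds\<close>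

text \<open>
  Symmetric open intervals around the initial time suffice here, and they allow two-sided derivatives
  throughout.
\<close>

definition solves_on :: "real \<Rightarrow> ('a::real_normed_vector \<Rightarrow> 'a) \<Rightarrow> (real \<Rightarrow> 'a) \<Rightarrow> bool"
  where "solves_on T F X \<longleftrightarrow> (\<forall>t. \<bar>t\<bar> < T \<longrightarrow> (X has_vector_derivative F (X t)) (at t))"

lemma solves_on_continuous_on:
  assumes "solves_on T F X" and "\<And>t. t \<in> S \<Longrightarrow> \<bar>t\<bar> < T"
  shows "continuous_on S X"
  by (rule continuous_on_if_has_vector_derivative[where f' = "\<lambda>t. F (X t)"])
    (use assms in \<open>auto simp: solves_on_def\<close>)

lemma solves_on_unique:
  fixes X Y :: "real \<Rightarrow> 'a::euclidean_space"
  assumes F: "locally_lipschitz F" and X: "solves_on T F X" and Y: "solves_on T F Y"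
    and "X 0 = Y 0" and "\<bar>t\<bar> < T"
  shows "X t = Y t"
proof -
  let ?I = "{-\<bar>t\<bar>..\<bar>t\<bar>}"
  have I: "\<And>s. s \<in> ?I \<Longrightarrow> \<bar>s\<bar> < T" using \<open>\<bar>t\<bar> < T\<close> by auto
  have "compact (X ` ?I \<union> Y ` ?I)"
    by (intro compact_Un compact_continuous_image solves_on_continuous_on[OF X I]
        solves_on_continuous_on[OF Y I]) auto
  then obtain L where L: "L-lipschitz_on (X ` ?I \<union> Y ` ?I) F"
    using F unfolding locally_lipschitz_def by blast
  have "X t - Y t = 0"
  proof (rule gronwall_zero[where T = "\<bar>t\<bar>" and L = L and D' = "\<lambda>t. F (X t) - F (Y t)"])
    fix s assume s: "\<bar>s\<bar> \<le> \<bar>t\<bar>"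
    show "((\<lambda>t. X t - Y t) has_vector_derivative F (X s) - F (Y s)) (at s)"
      using X Y s \<open>\<bar>t\<bar> < T\<close> unfolding solves_on_def by (intro has_vector_derivative_diff) auto
    have "s \<in> ?I" using s by auto
    then show "norm (F (X s) - F (Y s)) \<le> L * norm (X s - Y s)"
      by (intro lipschitz_on_normD[OF L]) auto
  qed (use \<open>X 0 = Y 0\<close> in auto)
  then show ?thesis by simp
qed

text \<open>
  Composing \<open>F\<close> with the nearest-point projection to a large ball makes it globally Lipschitz and
  bounded, so that the modified equation has a solution \<open>X\<close> on the whole line. As long as \<open>X\<close> is inside the
  ball it solves the original equation, and then the a priori bound keeps it away from the boundary: at
  the time \<open>e\<close> of smallest modulus at which \<open>X\<close> is not in the interior of the ball, continuity would
  give \<open>|X(e)| \<le> R < r\<close>.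
\<close>

lemma solution_on_bounded_interval:
  fixes F :: "'a::euclidean_space \<Rightarrow> 'a"
  assumes F: "locally_lipschitz F"
    and apriori: "\<And>\<tau> X t. \<tau> \<le> T \<Longrightarrow> solves_on \<tau> F X \<Longrightarrow> X 0 = x0 \<Longrightarrow> \<bar>t\<bar> < \<tau> \<Longrightarrow> norm (X t) \<le> R"
  obtains X where "X 0 = x0" "solves_on T F X"
proof -
  define r where "r = max (norm x0) R + 1"
  have r: "r > R" "r > norm x0" unfolding r_def by linarith+
  then have r0: "r \<ge> 0" using norm_ge_zero[of x0] by linarith
  let ?B = "cball (0::'a) r"
  have B: "convex ?B" "closed ?B" "?B \<noteq> {}" using r0 by auto
  define H where "H = F \<circ> closest_point ?B"
  obtain L where L: "L-lipschitz_on ?B F"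
    using F[unfolded locally_lipschitz_def, rule_format, OF compact_cball] by blast
  have cpB: "closest_point ?B x \<in> ?B" for x by (rule closest_point_in_set[OF B(2,3)])
  have H: "H x = F x" if "norm x \<le> r" for x
    using that by (simp add: H_def closest_point_self)
  have "1-lipschitz_on UNIV (closest_point ?B)"
    by (rule lipschitz_onI) (auto intro: closest_point_lipschitz[OF B])
  then have "(L * 1)-lipschitz_on UNIV H"
    unfolding H_def
    by (rule lipschitz_on_compose) (rule lipschitz_on_subset[OF L], use cpB in auto)
  moreover obtain M where "\<And>x. x \<in> ?B \<Longrightarrow> norm (F x) \<le> M"
    using continuous_on_compact_norm_bound[OF compact_cball
        locally_lipschitz_continuous_on[OF F compact_cball]] by blast
  then have "norm (H x) \<le> M" for x using cpB unfolding H_def o_def by blast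
  ultimately obtain X where X: "X 0 = x0" "\<And>t. (X has_vector_derivative H (X t)) (at t)"
    using picard_bounded_lipschitz[of "L * 1" H M x0] by blast
  have contX: "continuous_on S X" for S
    by (rule continuous_on_if_has_vector_derivative) (rule X(2))
  have small: "norm (X t) < r" if "\<bar>t\<bar> < T" for t
  proof (rule ccontr)
    assume "\<not> norm (X t) < r"
    \<comment> \<open>The first exit, in either direction of time.\<close>
    define E where "E = {-\<bar>t\<bar>..\<bar>t\<bar>} \<inter> {s. r \<le> norm (X s)}"
    have "closed {s. r \<le> norm (X s)}"
      by (intro closed_Collect_le continuous_on_const continuous_on_norm contX)
    then have "compact E" unfolding E_def by (intro compact_Int_closed compact_Icc)
    moreover have "t \<in> E" using \<open>\<not> norm (X t) < r\<close> by (auto simp: E_def)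
    ultimately obtain e where e: "e \<in> E" "\<And>s. s \<in> E \<Longrightarrow> \<bar>e\<bar> \<le> \<bar>s\<bar>"
      using continuous_attains_inf[of E abs] continuous_on_rabs[OF continuous_on_id] by blast
    have inside: "norm (X s) < r" if "\<bar>s\<bar> < \<bar>e\<bar>" for s
    proof (rule ccontr)
      assume "\<not> norm (X s) < r"
      then have "s \<in> E" using e(1) that by (auto simp: E_def)
      then show False using e(2) that by fastforce
    qed
    have sol: "solves_on \<bar>e\<bar> F X"
      unfolding solves_on_def using X(2) H inside by (metis less_imp_le)
    have "\<bar>e\<bar> \<le> T" using e \<open>\<bar>t\<bar> < T\<close> by (auto simp: E_def)
    have "e \<noteq> 0" using e r X(1) by (auto simp: E_def)
    have "norm (X e) \<le> R"
    proof (rule tendsto_upperbound)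
      \<comment> \<open>The bound holds at the times \<open>s e\<close> with \<open>0 < s < 1\<close>, whatever the sign of \<open>e\<close>.\<close>
      show "((\<lambda>s. norm (X (s * e))) \<longlongrightarrow> norm (X e)) (at_left 1)"
      proof -
        have "continuous (at_left 1) (\<lambda>s. norm (X (s * e)))"
          using contX[of UNIV]
          by (intro continuous_on_imp_continuous_within[of UNIV] continuous_on_norm
              continuous_on_compose2[OF contX[of UNIV]] continuous_intros) auto
        then show ?thesis by (simp add: continuous_within)
      qed
      have "\<forall>\<^sub>F s in at_left (1::real). s \<in> {0<..<1}"
        by (rule eventually_at_left_real) simp
      then show "\<forall>\<^sub>F s in at_left 1. norm (X (s * e)) \<le> R"
      proof eventually_elim
        case (elim s)
        then have "\<bar>s * e\<bar> < \<bar>e\<bar>" using \<open>e \<noteq> 0\<close> by (simp add: abs_mult)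
        then show ?case using apriori[OF \<open>\<bar>e\<bar> \<le> T\<close> sol X(1)] by blast
      qed
    qed simp
    then show False using e(1) r by (auto simp: E_def)
  qed
  show thesis
  proof (rule that[of X])
    show "solves_on T F X"
      unfolding solves_on_def using X(2) H small by (metis less_imp_le)
  qed (rule X(1))
qed

text \<open>
  The solutions on bounded intervals agree on overlaps by uniqueness, so they glue to a solution on the line.
\<close>

lemma global_solution_if_apriori_bounds:
  fixes F :: "'a::euclidean_space \<Rightarrow> 'a"
  assumes F: "locally_lipschitz F"
    and apriori: "\<And>\<tau> X t. solves_on \<tau> F X \<Longrightarrow> X 0 = x0 \<Longrightarrow> \<bar>t\<bar> < \<tau> \<Longrightarrow> norm (X t) \<le> R \<tau>"
    and "mono R"
  obtains X where "X 0 = x0" "\<And>t. (X has_vector_derivative F (X t)) (at t)"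
proof -
  have "\<exists>X. X 0 = x0 \<and> solves_on T F X" for T
  proof (rule solution_on_bounded_interval[OF F])
    show "norm (X t) \<le> R T" if "\<tau> \<le> T" "solves_on \<tau> F X" "X 0 = x0" "\<bar>t\<bar> < \<tau>" for \<tau> X t
      using apriori[OF that(2-4)] monoD[OF \<open>mono R\<close> that(1)] by (rule order_trans)
  qed blast
  then obtain Y where Y: "\<And>T. Y T 0 = x0" "\<And>T. solves_on T F (Y T)" by metis
  define X where "X t = Y (\<bar>t\<bar> + 1) t" for t
  have eq: "X t = Y T t" if "\<bar>t\<bar> < T" for t T
  proof -
    let ?T = "min T (\<bar>t\<bar> + 1)"
    have "solves_on ?T F (Y T)" "solves_on ?T F (Y (\<bar>t\<bar> + 1))"
      using Y(2)[of T] Y(2)[of "\<bar>t\<bar> + 1"] unfolding solves_on_def by auto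
    moreover have "\<bar>t\<bar> < ?T" using that by simp
    ultimately show ?thesis
      unfolding X_def using solves_on_unique[OF F, of ?T "Y (\<bar>t\<bar> + 1)" "Y T" t] by (simp add: Y(1))
  qed
  show thesis
  proof (rule that[of X])
    show "X 0 = x0" by (simp add: X_def Y)
    fix t :: real
    define T :: real where "T = \<bar>t\<bar> + 1"
    have "(Y T has_vector_derivative F (X t)) (at t)"
      using Y(2)[of T] eq[of t T] unfolding solves_on_def T_def by auto
    then show "(X has_vector_derivative F (X t)) (at t)"
      by (rule has_vector_derivative_transform_within_open[of _ _ _ "{-T<..<T}"])
        (auto simp: T_def abs_less_iff intro!: eq[symmetric])
  qed
qed

section \<open>Smoothness of curves by repeated differentiation\<close>

lemma vderiv_eq: "(f has_vector_derivative f') (at t) \<Longrightarrow> vderiv f t = f'"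
  unfolding vderiv_def by (rule vector_derivative_at)

lemma has_vector_derivative_vderiv:
  "f differentiable (at t) \<Longrightarrow> (f has_vector_derivative vderiv f t) (at t)"
  unfolding vderiv_def by (simp add: vector_derivative_works)

fun times_differentiable :: "nat \<Rightarrow> (real \<Rightarrow> 'a::real_normed_vector) \<Rightarrow> bool"
  where
    "times_differentiable 0 f \<longleftrightarrow> True"
  | "times_differentiable (Suc n) f \<longleftrightarrow>
      (\<exists>f'. (\<forall>t. (f has_vector_derivative f' t) (at t)) \<and> times_differentiable n f')"

lemma times_differentiable_SucI:
  assumes "\<And>t. (f has_vector_derivative f' t) (at t)" and "times_differentiable n f'"
  shows "times_differentiable (Suc n) f"
  using assms by auto

declare times_differentiable.simps(2) [simp del]

lemma times_differentiable_SucD: "times_differentiable (Suc n) f \<Longrightarrow> times_differentiable n f"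
proof (induction n arbitrary: f)
  case (Suc n)
  obtain f' where f': "\<And>t. (f has_vector_derivative f' t) (at t)" "times_differentiable (Suc n) f'"
    using Suc.prems unfolding times_differentiable.simps(2) by blast
  then show ?case using Suc.IH[OF f'(2)] f'(1) by (blast intro: times_differentiable_SucI)
qed simp

lemma times_differentiable_const: "times_differentiable n (\<lambda>t. c)"
proof (induction n arbitrary: c)
  case (Suc n)
  then show ?case by (intro times_differentiable_SucI[OF has_vector_derivative_const])
qed simp

lemma times_differentiable_add:
  "times_differentiable n f \<Longrightarrow> times_differentiable n g \<Longrightarrow> times_differentiable n (\<lambda>t. f t + g t)"
proof (induction n arbitrary: f g)
  case (Suc n)
  obtain f' where f: "\<And>t. (f has_vector_derivative f' t) (at t)" "times_differentiable n f'"
    using Suc.prems(1) unfolding times_differentiable.simps(2) by blast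
  obtain g' where g: "\<And>t. (g has_vector_derivative g' t) (at t)" "times_differentiable n g'"
    using Suc.prems(2) unfolding times_differentiable.simps(2) by blast
  have "((\<lambda>t. f t + g t) has_vector_derivative f' t + g' t) (at t)" for t
    by (intro has_vector_derivative_add f g)
  then show ?case using Suc.IH[OF f(2) g(2)] by (rule times_differentiable_SucI)
qed simp

text \<open>
  The Leibniz rule, by induction on the order: the derivative is a sum of two terms of the same shape.
\<close>

lemma times_differentiable_bilinear:
  assumes h: "bounded_bilinear h"
  shows "times_differentiable n f \<Longrightarrow> times_differentiable n g \<Longrightarrow>
    times_differentiable n (\<lambda>t. h (f t) (g t))"
proof (induction n arbitrary: f g)
  case (Suc n)
  obtain f' where f: "\<And>t. (f has_vector_derivative f' t) (at t)" "times_differentiable n f'"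
    using Suc.prems(1) unfolding times_differentiable.simps(2) by blast
  obtain g' where g: "\<And>t. (g has_vector_derivative g' t) (at t)" "times_differentiable n g'"
    using Suc.prems(2) unfolding times_differentiable.simps(2) by blast
  have "((\<lambda>t. h (f t) (g t)) has_vector_derivative h (f t) (g' t) + h (f' t) (g t)) (at t)" for t
    by (rule bounded_bilinear.has_vector_derivative[OF h f(1) g(1)])
  moreover have "times_differentiable n (\<lambda>t. h (f t) (g' t) + h (f' t) (g t))"
    using Suc.prems[THEN times_differentiable_SucD] f(2) g(2)
    by (intro times_differentiable_add Suc.IH)
  ultimately show ?case by (rule times_differentiable_SucI)
qed simp

text \<open>
  The derivative \<open>- f' (1/f) (1/f)\<close> involves only \<open>f'\<close> and \<open>1/f\<close> itself, which have one order less by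
  hypothesis and by induction.
\<close>

lemma times_differentiable_inverse:
  fixes f :: "real \<Rightarrow> real"
  assumes nz: "\<And>t. f t \<noteq> 0"
  shows "times_differentiable n f \<Longrightarrow> times_differentiable n (\<lambda>t. inverse (f t))"
proof (induction n)
  case (Suc n)
  obtain f' where f: "\<And>t. (f has_vector_derivative f' t) (at t)" "times_differentiable n f'"
    using Suc.prems unfolding times_differentiable.simps(2) by blast
  have "((\<lambda>t. inverse (f t)) has_vector_derivative (-1) * (f' t * (inverse (f t) * inverse (f t)))) (at t)" for t
    using f(1)[of t] nz[of t] unfolding has_real_derivative_iff_has_vector_derivative[symmetric]
    by (auto intro!: derivative_eq_intros)
  moreover have "times_differentiable n (\<lambda>t. (-1) * (f' t * (inverse (f t) * inverse (f t))))"
    using Suc.IH[OF Suc.prems[THEN times_differentiable_SucD]] f(2)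
    by (intro times_differentiable_bilinear[OF bounded_bilinear_mult] times_differentiable_const)
  ultimately show ?case by (rule times_differentiable_SucI)
qed simp

lemma times_differentiable_iterated_vderiv:
  assumes "times_differentiable (Suc n) f"
  shows "(vderiv ^^ n) f differentiable (at t)"
  using assms
proof (induction n arbitrary: f)
  case 0
  then show ?case by (auto intro: differentiableI_vector simp: times_differentiable.simps(2))
next
  case (Suc n)
  obtain f' where f': "\<And>t. (f has_vector_derivative f' t) (at t)" "times_differentiable (Suc n) f'"
    using Suc.prems unfolding times_differentiable.simps(2) by blast
  from f'(1) have "vderiv f = f'" by (intro ext vderiv_eq)
  then show ?case using Suc.IH[OF f'(2)] by (simp add: funpow_swap1)
qed

lemma smooth_curve_on_UNIVI: "(\<And>n. times_differentiable n f) \<Longrightarrow> smooth_curve_on UNIV f"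
  unfolding smooth_curve_on_def using times_differentiable_iterated_vderiv by blast

lemma smooth_curve_on_vderiv:
  assumes "smooth_curve_on I f" and "t \<in> I"
  shows "(f has_vector_derivative vderiv f t) (at t)"
    and "(vderiv f has_vector_derivative vderiv (vderiv f) t) (at t)"
  using assms unfolding smooth_curve_on_def
  by (metis funpow_0 has_vector_derivative_vderiv,
      metis funpow_0 funpow.simps(2) o_apply has_vector_derivative_vderiv)

section \<open>The geodesic equation as a vector field on the whole phase space\<close>

text \<open>
  This is \<open>det A - 1\<close>, written through the bilinear map so that the closure rules for sums and bilinear maps
  apply to it.
\<close>

definition det_defect :: "real^3^3 \<Rightarrow> real"
  where "det_defect A = (1/3) * (A \<bullet> cofactor_matrix A) + (-1)"

text \<open>
  On \<open>SL(3)\<close> this is \<open>|cof A|\<^sup>2\<close>, the denominator of \<open>\<Lambda>\<close>. The second summand makes it positive on the whole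
  matrix space.
\<close>

definition regularized_norm_sq :: "real^3^3 \<Rightarrow> real"
  where "regularized_norm_sq A
    = cofactor_matrix A \<bullet> cofactor_matrix A + det_defect A * det_defect A"

text \<open>
  For tangent vectors \<open>V\<close> at points \<open>A\<close> of \<open>SL(3)\<close> this is \<open>\<Lambda> A\<^sup>-\<^sup>T\<close>, see \<open>acceleration_eq_Lam\<close>.
\<close>

definition acceleration :: "real^3^3 \<Rightarrow> real^3^3 \<Rightarrow> real^3^3"
  where "acceleration A V
    = (((-2) * (A \<bullet> cofactor_matrix V)) * inverse (regularized_norm_sq A)) *\<^sub>R cofactor_matrix A"

definition phase_field :: "(real^3^3) \<times> (real^3^3) \<Rightarrow> (real^3^3) \<times> (real^3^3)"
  where "phase_field X = (snd X, acceleration (fst X) (snd X))"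

lemma det_defect_eq: "det_defect A = det A - 1"
  by (simp add: det_defect_def inner_cofactor_self)

lemma det_defect_SL3: "A \<in> SL3 \<longleftrightarrow> det_defect A = 0"
  by (simp add: det_defect_eq SL3_def)

text \<open>
  Since \<open>det A = \<langle>A, cof A\<rangle> / 3\<close>, the two summands cannot vanish together.
\<close>

lemma regularized_norm_sq_pos: "regularized_norm_sq A > 0"
proof (cases "cofactor_matrix A = 0")
  case True
  then show ?thesis by (simp add: regularized_norm_sq_def det_defect_def)
next
  case False
  then have "cofactor_matrix A \<bullet> cofactor_matrix A > 0" by simp
  moreover have "det_defect A * det_defect A \<ge> 0" by simp
  ultimately show ?thesis unfolding regularized_norm_sq_def by linarith
qed

lemma locally_lipschitz_phase_field: "locally_lipschitz phase_field"
proof -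
  note lip = locally_lipschitz_bilinear[OF bounded_bilinear_scaleR]
    locally_lipschitz_bilinear[OF bounded_bilinear_mult]
    locally_lipschitz_bilinear[OF bounded_bilinear_inner]
    locally_lipschitz_bilinear[OF bounded_bilinear_mixed_cofactor]
    locally_lipschitz_const locally_lipschitz_add
    locally_lipschitz_linear[OF bounded_linear_fst] locally_lipschitz_linear[OF bounded_linear_snd]
  have "locally_lipschitz (\<lambda>X :: (real^3^3) \<times> (real^3^3). regularized_norm_sq (fst X))"
    unfolding regularized_norm_sq_def det_defect_def by (intro lip)
  then have "locally_lipschitz (\<lambda>X :: (real^3^3) \<times> (real^3^3). inverse (regularized_norm_sq (fst X)))"
    by (rule locally_lipschitz_inverse) (rule regularized_norm_sq_pos)
  then show ?thesis
    unfolding phase_field_def acceleration_def by (intro locally_lipschitz_Pair lip)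
qed

lemma times_differentiable_acceleration:
  assumes A: "times_differentiable n A" and V: "times_differentiable n V"
  shows "times_differentiable n (\<lambda>t. acceleration (A t) (V t))"
proof -
  note diff = times_differentiable_bilinear[OF bounded_bilinear_scaleR]
    times_differentiable_bilinear[OF bounded_bilinear_mult]
    times_differentiable_bilinear[OF bounded_bilinear_inner]
    times_differentiable_bilinear[OF bounded_bilinear_mixed_cofactor]
    times_differentiable_const times_differentiable_add A V
  have "times_differentiable n (\<lambda>t. regularized_norm_sq (A t))"
    unfolding regularized_norm_sq_def det_defect_def by (intro diff)
  then have "times_differentiable n (\<lambda>t. inverse (regularized_norm_sq (A t)))"
    by (rule times_differentiable_inverse[rotated]) (metis regularized_norm_sq_pos less_irrefl)
  then show ?thesis unfolding acceleration_def by (intro diff)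
qed

text \<open>
  Bootstrapping: if \<open>A\<close> and \<open>V\<close> are \<open>n\<close> times differentiable, then so are their derivatives, as both are
  smooth expressions in \<open>A\<close> and \<open>V\<close>.
\<close>

lemma smooth_if_second_order:
  assumes A: "\<And>t. (A has_vector_derivative V t) (at t)"
    and V: "\<And>t. (V has_vector_derivative acceleration (A t) (V t)) (at t)"
  shows "smooth_curve_on UNIV A"
proof (rule smooth_curve_on_UNIVI)
  have "times_differentiable n A \<and> times_differentiable n V" for n
    by (induction n)
      (auto intro: times_differentiable_SucI[OF A] times_differentiable_SucI[OF V]
        times_differentiable_acceleration)
  then show "times_differentiable n A" for n by blast
qed

section \<open>Conserved quantities\<close>

lemma cofactor_matrix_has_vector_derivative:
  assumes "(A has_vector_derivative V) (at t)"
  shows "((\<lambda>t. cofactor_matrix (A t)) has_vector_derivative 2 *\<^sub>R mixed_cofactor (A t) V) (at t)"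
  using bounded_bilinear.has_vector_derivative[OF bounded_bilinear_mixed_cofactor assms assms]
  by (simp add: mixed_cofactor_commute[of V] scaleR_2)

text \<open>
  Jacobi's formula: the gradient of the determinant is the cofactor matrix.
\<close>

lemma det_defect_has_vector_derivative:
  assumes "(A has_vector_derivative V) (at t)"
  shows "((\<lambda>t. det_defect (A t)) has_vector_derivative cofactor_matrix (A t) \<bullet> V) (at t)"
proof -
  have "((\<lambda>t. A t \<bullet> cofactor_matrix (A t)) has_vector_derivative
      A t \<bullet> 2 *\<^sub>R mixed_cofactor (A t) V + V \<bullet> cofactor_matrix (A t)) (at t)"
    by (rule bounded_bilinear.has_vector_derivative[OF bounded_bilinear_inner assms
          cofactor_matrix_has_vector_derivative[OF assms]])
  also have "A t \<bullet> 2 *\<^sub>R mixed_cofactor (A t) V + V \<bullet> cofactor_matrix (A t)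
      = 3 * (cofactor_matrix (A t) \<bullet> V)"
    using inner_mixed_cofactor_swap[of "A t" V "A t"]
    by (simp add: mixed_cofactor_commute[of _ V] inner_commute)
  finally show ?thesis
    unfolding det_defect_def by (auto intro!: derivative_eq_intros)
qed

text \<open>
  A curve in \<open>SL(3)\<close> has constant determinant, so Jacobi's formula gives zero.
\<close>

lemma tangent_to_SL3:
  assumes "(A has_vector_derivative V) (at t)" and "open I" "t \<in> I" "A ` I \<subseteq> SL3"
  shows "cofactor_matrix (A t) \<bullet> V = 0"
proof -
  have "((\<lambda>t. 0) has_vector_derivative cofactor_matrix (A t) \<bullet> V) (at t)"
    by (rule has_vector_derivative_transform_within_open[OF det_defect_has_vector_derivative])
      (use assms in \<open>auto simp: det_defect_SL3\<close>)
  then show ?thesis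
    using has_vector_derivative_const vector_derivative_at by metis
qed

text \<open>
  Off \<open>SL(3)\<close> the regularized field need not keep \<open>\<langle>cof A, V\<rangle>\<close> constant, but the error is proportional to
  the square of \<open>det A - 1\<close>. The pair \<open>(d, w)\<close> thus solves a homogeneous linear system with continuous
  coefficients and zero initial value.
\<close>

lemma constraints_preserved:
  assumes A: "\<And>t. \<bar>t\<bar> < T \<Longrightarrow> (A has_vector_derivative V t) (at t)"
    and V: "\<And>t. \<bar>t\<bar> < T \<Longrightarrow> (V has_vector_derivative acceleration (A t) (V t)) (at t)"
    and "A 0 \<in> SL3" and "cofactor_matrix (A 0) \<bullet> V 0 = 0" and "\<bar>t\<bar> < T"
  shows "A t \<in> SL3" and "cofactor_matrix (A t) \<bullet> V t = 0"
proof -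
  define d where "d t = det_defect (A t)" for t
  define w where "w t = cofactor_matrix (A t) \<bullet> V t" for t
  define g where "g t = 2 * (A t \<bullet> cofactor_matrix (V t)) * d t
      * inverse (regularized_norm_sq (A t))" for t
  have d': "(d has_vector_derivative w s) (at s)" if "\<bar>s\<bar> < T" for s
    unfolding d_def w_def by (rule det_defect_has_vector_derivative[OF A[OF that]])
  have w': "(w has_vector_derivative g s * d s) (at s)" if "\<bar>s\<bar> < T" for s
  proof -
    have "(w has_vector_derivative cofactor_matrix (A s) \<bullet> acceleration (A s) (V s)
        + 2 *\<^sub>R mixed_cofactor (A s) (V s) \<bullet> V s) (at s)"
      unfolding w_def
      by (rule bounded_bilinear.has_vector_derivative[OF bounded_bilinear_inner
            cofactor_matrix_has_vector_derivative[OF A[OF that]] V[OF that]])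
    also have "2 *\<^sub>R mixed_cofactor (A s) (V s) \<bullet> V s = 2 * (A s \<bullet> cofactor_matrix (V s))"
      by (simp add: inner_commute[of _ "V s"] inner_mixed_cofactor_swap[of "V s"])
    also have "cofactor_matrix (A s) \<bullet> acceleration (A s) (V s) + 2 * (A s \<bullet> cofactor_matrix (V s))
        = g s * d s"
    proof -
      let ?N = "regularized_norm_sq (A s)" and ?q = "A s \<bullet> cofactor_matrix (V s)"
      \<comment> \<open>With \<open>N = |cof A|\<^sup>2 + d\<^sup>2\<close> the acceleration cancels \<open>2 \<langle>A, cof V\<rangle>\<close> up to the factor \<open>d\<^sup>2 / N\<close>.\<close>
      have "cofactor_matrix (A s) \<bullet> acceleration (A s) (V s)
          = (-2) * ?q * inverse ?N * (?N - d s * d s)"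
        by (simp add: acceleration_def regularized_norm_sq_def d_def)
      then show ?thesis
        using regularized_norm_sq_pos[of "A s"] by (simp add: g_def field_simps)
    qed
    finally show ?thesis .
  qed
  let ?I = "{-\<bar>t\<bar>..\<bar>t\<bar>}"
  have I: "\<bar>s\<bar> < T" if "s \<in> ?I" for s using that \<open>\<bar>t\<bar> < T\<close> by auto
  have contA: "continuous_on ?I A"
    by (rule continuous_on_if_has_vector_derivative) (rule A[OF I])
  have contV: "continuous_on ?I V"
    by (rule continuous_on_if_has_vector_derivative) (rule V[OF I])
  have contd: "continuous_on ?I d"
    by (rule continuous_on_if_has_vector_derivative) (rule d'[OF I])
  have contcof: "continuous_on ?I (\<lambda>s. mixed_cofactor (f s) (h s))"
    if "continuous_on ?I f" "continuous_on ?I h" for f h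
    by (rule bounded_bilinear.continuous_on[OF bounded_bilinear_mixed_cofactor that])
  have "continuous_on ?I g"
    unfolding g_def
  proof (intro continuous_intros contA contV contd contcof)
    show "continuous_on ?I (\<lambda>s. regularized_norm_sq (A s))"
      unfolding regularized_norm_sq_def det_defect_def
      by (intro continuous_intros contA contcof)
    show "\<forall>s\<in>?I. regularized_norm_sq (A s) \<noteq> 0"
      by (metis regularized_norm_sq_pos less_irrefl)
  qed
  then have "\<exists>G. \<forall>s\<in>?I. norm (g s) \<le> G"
    by (rule continuous_on_compact_norm_bound[OF compact_Icc])
  then obtain G where G: "\<And>s. s \<in> ?I \<Longrightarrow> norm (g s) \<le> G" by blast
  have "(d t, w t) = 0"
  proof (rule gronwall_zero[where T = "\<bar>t\<bar>" and D = "\<lambda>s. (d s, w s)" and L = "1 + G"])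
    fix s assume s: "\<bar>s\<bar> \<le> \<bar>t\<bar>"
    then have sT: "\<bar>s\<bar> < T" and sI: "s \<in> ?I" using \<open>\<bar>t\<bar> < T\<close> by auto
    show "((\<lambda>s. (d s, w s)) has_vector_derivative (w s, g s * d s)) (at s)"
      by (intro has_vector_derivative_Pair d' w' sT)
    have "norm (w s, g s * d s) \<le> norm (w s) + norm (g s * d s)"
      by (rule norm_Pair_le)
    also have "\<dots> = norm (w s) + norm (g s) * norm (d s)" by (simp add: abs_mult)
    also have "\<dots> \<le> norm (d s, w s) + G * norm (d s, w s)"
      using norm_snd_le[of "w s" "d s"] norm_fst_le[of "d s" "w s"] G[OF sI]
      by (intro add_mono mult_mono) (auto intro: order_trans[OF norm_ge_zero])
    finally show "norm (w s, g s * d s) \<le> (1 + G) * norm (d s, w s)"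
      by (simp add: algebra_simps)
  qed (use assms(3,4) in \<open>auto simp: d_def w_def det_defect_SL3 zero_prod_def\<close>)
  then show "A t \<in> SL3" and "cofactor_matrix (A t) \<bullet> V t = 0"
    by (simp_all add: d_def w_def det_defect_SL3 zero_prod_def)
qed

text \<open>
  The acceleration is a multiple of \<open>cof A\<close>, to which the velocity is orthogonal.
\<close>

lemma speed_preserved:
  assumes A: "\<And>t. \<bar>t\<bar> < T \<Longrightarrow> (A has_vector_derivative V t) (at t)"
    and V: "\<And>t. \<bar>t\<bar> < T \<Longrightarrow> (V has_vector_derivative acceleration (A t) (V t)) (at t)"
    and "A 0 \<in> SL3" and "cofactor_matrix (A 0) \<bullet> V 0 = 0" and "\<bar>t\<bar> < T"
  shows "norm (V t) = norm (V 0)"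
proof -
  have "V t \<bullet> V t - V 0 \<bullet> V 0 = 0"
  proof (rule gronwall_zero[where T = "\<bar>t\<bar>" and L = 0
        and D = "\<lambda>s. V s \<bullet> V s - V 0 \<bullet> V 0" and D' = "\<lambda>s. 0"])
    fix s assume "\<bar>s\<bar> \<le> \<bar>t\<bar>"
    then have s: "\<bar>s\<bar> < T" using \<open>\<bar>t\<bar> < T\<close> by simp
    have "((\<lambda>s. V s \<bullet> V s) has_vector_derivative
        V s \<bullet> acceleration (A s) (V s) + acceleration (A s) (V s) \<bullet> V s) (at s)"
      by (rule bounded_bilinear.has_vector_derivative[OF bounded_bilinear_inner V[OF s] V[OF s]])
    then show "((\<lambda>s. V s \<bullet> V s - V 0 \<bullet> V 0) has_vector_derivative 0) (at s)"
      using constraints_preserved(2)[OF A V assms(3,4) s]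
      by (auto intro!: derivative_eq_intros simp: acceleration_def inner_commute[of "V s"])
  qed auto
  then show ?thesis by (simp add: norm_eq_sqrt_inner)
qed

section \<open>Existence and uniqueness of global solutions\<close>

lemma phase_field_iff:
  "(X has_vector_derivative phase_field (X t)) (at t) \<longleftrightarrow>
    ((\<lambda>t. fst (X t)) has_vector_derivative snd (X t)) (at t) \<and>
    ((\<lambda>t. snd (X t)) has_vector_derivative acceleration (fst (X t)) (snd (X t))) (at t)"
  (is "?L \<longleftrightarrow> ?R")
proof
  assume ?L
  from bounded_linear.has_vector_derivative[OF bounded_linear_fst this]
    bounded_linear.has_vector_derivative[OF bounded_linear_snd this]
  show ?R by (simp add: phase_field_def)
next
  assume ?R
  then have "((\<lambda>t. (fst (X t), snd (X t))) has_vector_derivative phase_field (X t)) (at t)"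
    unfolding phase_field_def by (intro has_vector_derivative_Pair) auto
  then show ?L by simp
qed

text \<open>
  Constant speed bounds the velocity, and by the mean value inequality it bounds the position linearly in
  time. These are the a priori bounds that exclude blow-up.
\<close>

lemma phase_field_global_solution:
  assumes "A0 \<in> SL3" and "cofactor_matrix A0 \<bullet> V0 = 0"
  obtains X where "X 0 = (A0, V0)" "\<And>t. (X has_vector_derivative phase_field (X t)) (at t)"
proof (rule global_solution_if_apriori_bounds[OF locally_lipschitz_phase_field])
  show "mono (\<lambda>\<tau>. norm A0 + norm V0 * \<tau> + norm V0)"
    by (intro monoI add_mono mult_left_mono) auto
  fix \<tau> t and X :: "real \<Rightarrow> (real^3^3) \<times> (real^3^3)"
  assume X: "solves_on \<tau> phase_field X" "X 0 = (A0, V0)" and t: "\<bar>t\<bar> < \<tau>"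
  define A where "A t = fst (X t)" for t
  define V where "V t = snd (X t)" for t
  have A: "(A has_vector_derivative V s) (at s)"
    and V: "(V has_vector_derivative acceleration (A s) (V s)) (at s)" if "\<bar>s\<bar> < \<tau>" for s
    using X(1) that unfolding solves_on_def phase_field_iff A_def V_def by blast+
  have init: "A 0 = A0" "V 0 = V0" by (simp_all add: A_def V_def X)
  have speed: "norm (V s) = norm V0" if "\<bar>s\<bar> < \<tau>" for s
    using speed_preserved[OF A V _ _ that] assms by (simp add: init)
  have "norm (A t - A 0) \<le> norm V0 * norm (t - 0)"
  proof (rule differentiable_bound[where S = "{-\<tau><..<\<tau>}" and f' = "\<lambda>s h. h *\<^sub>R V s"])
    fix s assume "s \<in> {-\<tau><..<\<tau>}"
    then have s: "\<bar>s\<bar> < \<tau>" by auto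
    show "(A has_derivative (\<lambda>h. h *\<^sub>R V s)) (at s within {-\<tau><..<\<tau>})"
      using A[OF s] unfolding has_vector_derivative_def by (rule has_derivative_at_withinI)
    show "onorm (\<lambda>h. h *\<^sub>R V s) \<le> norm V0"
      by (rule onorm_le) (simp add: speed[OF s] mult.commute)
  qed (use t in auto)
  then have "norm (A t) \<le> norm A0 + norm V0 * \<bar>t\<bar>"
    using norm_triangle_sub[of "A t" "A 0"] by (simp add: init)
  also have "\<dots> \<le> norm A0 + norm V0 * \<tau>" using t by (intro add_left_mono mult_left_mono) auto
  finally have "norm (A t) + norm (V t) \<le> norm A0 + norm V0 * \<tau> + norm V0"
    using speed[OF t] by simp
  then show "norm (X t) \<le> norm A0 + norm V0 * \<tau> + norm V0"
    using norm_Pair_le[of "A t" "V t"] by (simp add: A_def V_def)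
qed (use that in blast)

lemma acceleration_eq_Lam:
  assumes "A t \<in> SL3" and "cofactor_matrix (A t) \<bullet> vderiv A t = 0"
  shows "Lam A t *\<^sub>R inv_transpose (A t) = acceleration (A t) (vderiv A t)"
proof -
  have "regularized_norm_sq (A t) = (norm (cofactor_matrix (A t)))\<^sup>2"
    using assms(1) by (simp add: regularized_norm_sq_def det_defect_SL3 power2_norm_eq_inner)
  moreover have "Lam A t = (-2) * (A t \<bullet> cofactor_matrix (vderiv A t))
      * inverse ((norm (cofactor_matrix (A t)))\<^sup>2)"
    unfolding Lam_def Let_def trace_velocity_sq[OF assms(1)] trace_inv_transpose[OF assms(1)]
    by (simp add: assms(2) divide_inverse)
  ultimately show ?thesis
    by (simp add: acceleration_def matrix_inv_SL3[OF assms(1)])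
qed

text \<open>
  The definition of a solution puts only the initial velocity under a tangency condition. Since the
  solution stays in \<open>SL(3)\<close>, all its velocities are tangent, and there the two equations agree.
\<close>

lemma global_solution_imp_phase_field:
  assumes "global_solution A0 V0 A"
  shows "(A has_vector_derivative vderiv A t) (at t)"
    and "(vderiv A has_vector_derivative acceleration (A t) (vderiv A t)) (at t)"
    and "cofactor_matrix (A t) \<bullet> vderiv A t = 0"
proof -
  have smooth: "smooth_curve_on UNIV A" and SL: "range A \<subseteq> SL3"
    and eq: "vderiv (vderiv A) t = Lam A t *\<^sub>R inv_transpose (A t)"
    using assms unfolding global_solution_def by blast+
  show A: "(A has_vector_derivative vderiv A t) (at t)"
    using smooth_curve_on_vderiv(1)[OF smooth] by simp
  show tan: "cofactor_matrix (A t) \<bullet> vderiv A t = 0"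
    by (rule tangent_to_SL3[OF A open_UNIV]) (use SL in auto)
  have "A t \<in> SL3" using SL by auto
  then show "(vderiv A has_vector_derivative acceleration (A t) (vderiv A t)) (at t)"
    using smooth_curve_on_vderiv(2)[OF smooth, of t] acceleration_eq_Lam[OF _ tan] eq by simp
qed

lemma global_solution_exists:
  assumes "A0 \<in> SL3" and "cofactor_matrix A0 \<bullet> V0 = 0"
  shows "\<exists>A. global_solution A0 V0 A"
proof -
  obtain X where X: "X 0 = (A0, V0)" "\<And>t. (X has_vector_derivative phase_field (X t)) (at t)"
    using phase_field_global_solution[OF assms] by blast
  define A where "A t = fst (X t)" for t
  define V where "V t = snd (X t)" for t
  have A: "(A has_vector_derivative V t) (at t)"
    and V: "(V has_vector_derivative acceleration (A t) (V t)) (at t)" for t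
    using X(2)[of t] unfolding phase_field_iff A_def V_def by auto
  have init: "A 0 = A0" "V 0 = V0" by (simp_all add: A_def V_def X)
  have V_eq: "vderiv A = V" using A by (intro ext vderiv_eq)
  have constr: "A t \<in> SL3" "cofactor_matrix (A t) \<bullet> V t = 0" for t
    using constraints_preserved[of "\<bar>t\<bar> + 1" A V t] A V assms by (simp_all add: init)
  have "global_solution A0 V0 A"
    unfolding global_solution_def
  proof (intro conjI allI)
    show "continuous_on UNIV A" by (rule continuous_on_if_has_vector_derivative) (rule A)
    show "range A \<subseteq> SL3" using constr by auto
    show "smooth_curve_on UNIV A" using A V by (rule smooth_if_second_order)
    fix t
    show "vderiv (vderiv A) t = Lam A t *\<^sub>R inv_transpose (A t)"
      using acceleration_eq_Lam[of A t] constr[of t] V[of t] by (simp add: V_eq vderiv_eq)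
  qed (simp_all add: init V_eq)
  then show ?thesis by blast
qed

lemma global_solution_unique:
  assumes A: "global_solution A0 V0 A" and B: "global_solution A0 V0 B"
  shows "A = B"
proof
  fix t
  let ?X = "\<lambda>t. (A t, vderiv A t)" and ?Y = "\<lambda>t. (B t, vderiv B t)"
  have "solves_on (\<bar>t\<bar> + 1) phase_field (\<lambda>t. (C t, vderiv C t))"
    if "global_solution A0 V0 C" for C
    unfolding solves_on_def phase_field_def fst_conv snd_conv
    by (intro allI impI has_vector_derivative_Pair global_solution_imp_phase_field[OF that])
  then have "solves_on (\<bar>t\<bar> + 1) phase_field ?X" "solves_on (\<bar>t\<bar> + 1) phase_field ?Y"
    using A B by blast+
  moreover have "?X 0 = ?Y 0" using A B by (simp add: global_solution_def)
  ultimately have "?X t = ?Y t"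
    using solves_on_unique[OF locally_lipschitz_phase_field, of "\<bar>t\<bar> + 1" ?X ?Y t] by simp
  then show "A t = B t" by simp
qed

lemma global_solution_speed:
  assumes "global_solution A0 V0 A"
  shows "norm (vderiv A t) = norm (vderiv A 0)"
proof (rule speed_preserved)
  show "A 0 \<in> SL3" using assms by (auto simp: global_solution_def)
  show "\<bar>t\<bar> < \<bar>t\<bar> + 1" by simp
qed (rule global_solution_imp_phase_field[OF assms])+

section \<open>Geodesics and curvature\<close>

lemma kinetic_energy_eq: "kinetic_energy A t = (norm (vderiv A t))\<^sup>2 / 2"
  by (simp add: kinetic_energy_def norm_matrix_sq)

lemma tangent_space_SL3_orthogonal:
  assumes "u \<in> tangent_space SL3 p"
  shows "cofactor_matrix p \<bullet> u = 0"
proof -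
  obtain \<gamma> \<epsilon> where \<gamma>: "\<epsilon> > 0" "smooth_curve_on {-\<epsilon><..<\<epsilon>} \<gamma>" "\<gamma> ` {-\<epsilon><..<\<epsilon>} \<subseteq> SL3"
      "\<gamma> 0 = p" "vderiv \<gamma> 0 = u"
    using assms unfolding tangent_space_def by blast
  have "cofactor_matrix (\<gamma> 0) \<bullet> vderiv \<gamma> 0 = 0"
  proof (rule tangent_to_SL3[OF _ _ _ \<gamma>(3)])
    show "(\<gamma> has_vector_derivative vderiv \<gamma> 0) (at 0)"
      using \<gamma>(1) by (intro smooth_curve_on_vderiv(1)[OF \<gamma>(2)]) auto
  qed (use \<gamma>(1) in auto)
  then show ?thesis by (simp add: \<gamma>)
qed

lemma zero_in_tangent_space:
  assumes "p \<in> S" shows "0 \<in> tangent_space S p"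
proof -
  have "(vderiv ^^ n) (\<lambda>t. p) differentiable (at t)" for n t
    by (intro times_differentiable_iterated_vderiv times_differentiable_const)
  then have "smooth_curve_on {-1<..<1} (\<lambda>t. p)" by (simp add: smooth_curve_on_def)
  moreover have "vderiv (\<lambda>t. p) 0 = 0" by (rule vderiv_eq) simp
  ultimately show ?thesis
    using assms unfolding tangent_space_def by (intro CollectI exI[of _ "\<lambda>t. p"] exI[of _ 1]) auto
qed

text \<open>
  Zero is the only candidate: a tangent vector \<open>w\<close> with \<open>v - w\<close> normal is orthogonal to itself when \<open>v\<close> is
  normal. The argument does not presuppose that the tangent space is closed under addition.
\<close>

lemma tangential_component_eq_0:
  assumes "p \<in> S" and orth: "\<And>u. u \<in> tangent_space S p \<Longrightarrow> orthogonal v u"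
  shows "tangential_component S p v = 0"
  unfolding tangential_component_def
proof (rule the_equality)
  show "0 \<in> tangent_space S p \<and> (\<forall>u\<in>tangent_space S p. orthogonal (v - 0) u)"
    using assms zero_in_tangent_space by auto
  fix w assume w: "w \<in> tangent_space S p \<and> (\<forall>u\<in>tangent_space S p. orthogonal (v - w) u)"
  then have "orthogonal (v - w) w" "orthogonal v w" using orth by auto
  then show "w = 0" by (simp add: orthogonal_def inner_diff_left)
qed

lemma global_solution_geodesic:
  assumes "global_solution A0 V0 A"
  shows "geodesic_in SL3 A"
  unfolding geodesic_in_def
proof (intro conjI allI)
  show SL: "range A \<subseteq> SL3" and "smooth_curve_on UNIV A"
    using assms unfolding global_solution_def by blast+
  fix t
  have "vderiv (vderiv A) t = acceleration (A t) (vderiv A t)"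
    by (rule vderiv_eq) (rule global_solution_imp_phase_field(2)[OF assms])
  then show "tangential_component SL3 (A t) (vderiv (vderiv A) t) = 0"
    using SL tangent_space_SL3_orthogonal
    by (intro tangential_component_eq_0) (auto simp: orthogonal_def acceleration_def)
qed

lemma arc_length_constant_speed:
  assumes "\<And>t. norm (vderiv A t) = c"
  shows "arc_length A t = c * t"
  using interval_integral_const(2)[of 0 t c] by (simp add: arc_length_def assms zero_ereal_def)

text \<open>
  For constant speed \<open>c\<close> the arc-length reparametrization is \<open>A(s / c)\<close>, whose second derivative is
  \<open>A'' / c\<^sup>2 = (\<Lambda> / c\<^sup>2) |cof A| n\<close>, where \<open>c\<^sup>2 = 2 E\<^sub>K(0)\<close>.
\<close>

lemma global_solution_curvature:
  assumes sol: "global_solution A0 V0 A" and "kinetic_energy A 0 > 0"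
  shows "has_signed_curvature A
    (trace ((vderiv A t ** matrix_inv (A t)) ** (vderiv A t ** matrix_inv (A t)))
      / (2 * kinetic_energy A 0 * sqrt (trace (inv_transpose (A t) ** matrix_inv (A t))))) t"
    (is "has_signed_curvature A ?\<kappa> t")
proof -
  define c where "c = norm (vderiv A 0)"
  have c: "c > 0" "2 * kinetic_energy A 0 = c * c"
    using \<open>kinetic_energy A 0 > 0\<close> by (auto simp: kinetic_energy_eq c_def power2_eq_square)
  have arc: "arc_length A = (\<lambda>t. c * t)"
    using arc_length_constant_speed[of A c] global_solution_speed[OF sol] by (auto simp: c_def)
  have "inv (arc_length A) = (\<lambda>s. inverse c * s)"
    unfolding arc using c by (intro inv_unique_comp) (auto simp: o_def)
  then have reparam: "arc_length_reparam A = (\<lambda>s. A (inverse c * s))"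
    by (auto simp: arc_length_reparam_def)
  have d1: "(arc_length_reparam A has_vector_derivative inverse c *\<^sub>R vderiv A (inverse c * s)) (at s)" for s
    unfolding reparam
    by (intro has_vector_derivative_scaled_argument global_solution_imp_phase_field(1)[OF sol])
  then have vd: "vderiv (arc_length_reparam A) = (\<lambda>s. inverse c *\<^sub>R vderiv A (inverse c * s))"
    by (intro ext vderiv_eq)
  have "(vderiv (arc_length_reparam A) has_vector_derivative
      inverse c *\<^sub>R (inverse c *\<^sub>R acceleration (A t) (vderiv A t))) (at (c * t))"
    unfolding vd
  proof (intro bounded_linear.has_vector_derivative[OF bounded_linear_scaleR_right]
      has_vector_derivative_scaled_argument)
    have "inverse c * (c * t) = t" using c by simp
    then show "(vderiv A has_vector_derivative acceleration (A t) (vderiv A t)) (at (inverse c * (c * t)))"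
      using global_solution_imp_phase_field(2)[OF sol, of t] by (simp only:)
  qed
  moreover have "inverse c *\<^sub>R (inverse c *\<^sub>R acceleration (A t) (vderiv A t)) = ?\<kappa> *\<^sub>R unit_normal (A t)"
  proof -
    have "A t \<in> SL3" using sol by (auto simp: global_solution_def)
    then show ?thesis
      using acceleration_eq_Lam[of A t] global_solution_imp_phase_field(3)[OF sol, of t] c
      by (simp add: Lam_def Let_def unit_normal_def trace_inv_transpose field_simps power2_eq_square
          flip: acceleration_eq_Lam)
  qed
  moreover have "bij (arc_length A)"
    unfolding arc using c by (intro bij_betw_byWitness[where f' = "\<lambda>s. inverse c * s"]) auto
  ultimately show ?thesis
    unfolding has_signed_curvature_def arc using d1 differentiableI_vector by metis
qed

theorem lemma4:
  fixes A0 V0 :: "real^3^3"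
  assumes "A0 \<in> SL3" and "trace (V0 ** matrix_inv A0) = 0"
  shows "(\<exists>!A. global_solution A0 V0 A) \<and>
    (\<forall>A. global_solution A0 V0 A \<longrightarrow>
      (\<forall>t. kinetic_energy A t = kinetic_energy A 0) \<and>
      (kinetic_energy A 0 > 0 \<longrightarrow>
        geodesic_in SL3 A \<and>
        (\<forall>t. has_signed_curvature A
          (trace ((vderiv A t ** matrix_inv (A t)) ** (vderiv A t ** matrix_inv (A t)))
            / (2 * kinetic_energy A 0
                * sqrt (trace (inv_transpose (A t) ** matrix_inv (A t)))))
          t)))"
proof -
  have "cofactor_matrix A0 \<bullet> V0 = 0"
    using assms by (simp add: inner_cofactor_eq_trace)
  then have "\<exists>!A. global_solution A0 V0 A"
    using global_solution_exists[OF assms(1)] global_solution_unique by blast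
  moreover have "kinetic_energy A t = kinetic_energy A 0" if "global_solution A0 V0 A" for A t
    unfolding kinetic_energy_eq by (simp only: global_solution_speed[OF that, of t])
  ultimately show ?thesis
    using global_solution_geodesic global_solution_curvature by blast
qed

end
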